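(* Let $n\ge 2$ and $N\ge 1$ be integers, let $\xi_1,\dots,\xi_N\in\mathbb{Z}^n$ (the columns of a direction matrix $[\xi_1,\dots,\xi_N]\in\mathbb{Z}^{n\times N}$), and let $m_1,\dots,m_N$ be positive integers (the entries of a vanishing moment vector). Let $\lambda\ge 2$ be an integer such that $N\le\lambda^n$, and let $\Lambda=\{\nu_1,\dots,\nu_{\lambda^n}\}\subset\mathbb{Z}^n$ be a complete set of representatives of the distinct cosets of $\mathbb{Z}^n/\lambda\mathbb{Z}^n$ containing $0$. Then there exist trigonometric polynomials $p_l$, $1\le l\le N$, on $\mathbb{T}^n$ such that the function $$\tau(\omega)=\sum_{l=1}^{N}\lambda^{-n/2}p_l(\lambda\omega)e^{i\nu_l\cdot\omega}+\sum_{l=N+1}^{\lambda^n}\lambda^{-n/2}e^{i\nu_l\cdot\omega}$$ (the second sum being empty if $N=\lambda^n$) is a lowpass mask with dilation $\lambda$, the functions $$q_{D,l}(\omega)=\lambda^{-n/2}2^{-m_l}\left(1-e^{-i\lambda\xi_l\cdot\omega}\right)^{m_l}\tau(\omega),\qquad 1\le l\le N,$$ $$q_{C,\mu}(\omega)=\begin{cases}e^{i\nu_\mu\cdot\omega}-\lambda^{-n/2}\tau(\omega)\overline{p_\mu(\lambda\omega)}, & 1\le\mu\le N,\\ e^{i\nu_\mu\cdot\omega}-\lambda^{-n/2}\tau(\omega), & N+1\le\mu\le\lambda^n,\end{cases}$$ are wavelet masks, and the collection $\{\tau,q_{D,1},\dots,q_{D,N},q_{C,1},\dots,q_{C,\lambda^n}\}$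 is a tight wavelet filter bank with dilation $\lambda$.
   Context: Write $\mathbb{T}^n=\mathbb{R}^n/2\pi\mathbb{Z}^n$. A trigonometric polynomial on $\mathbb{T}^n$ is a finite linear combination of the functions $\omega\mapsto e^{-ik\cdot\omega}$, $k\in\mathbb{Z}^n$. A mask is a trigonometric polynomial $\tau(\omega)=\sum_{k\in\mathbb{Z}^n}h(k)e^{-ik\cdot\omega}$ whose coefficient sequence $h:\mathbb{Z}^n\to\mathbb{R}$ (the associated filter, finitely supported) is real-valued. For an integer dilation $\lambda\ge2$, a mask $\tau$ is a lowpass mask if $\tau(0)=\lambda^{n/2}$, and a mask $q$ is a wavelet mask if $q(0)=0$. Let $\Gamma$ be a complete set of representatives, containing $0$, of the distinct cosets of $2\pi\left((\lambda^{-1}\mathbb{Z}^n)/\mathbb{Z}^n\right)$, e.g. $\Gamma=\{2\pi k/\lambda: k\in\{0,\dots,\lambda-1\}^n\}$. A collection $\{\tau,q_1,\dots,q_r\}$, with $\tau$ a lowpass mask and $q_1,\dots,q_r$ trigonometric polynomials, is a tight wavelet filter bank with dilation $\lambda$ if for all $\omega\in\mathbb{T}^n$ and all $\gamma\in\Gamma$, $$\tau(\omega)\overline{\tau(\omega+\gamma)}+\sum_{i=1}^r q_i(\omega)\overline{q_i(\omega+\gamma)}=\begin{cases}\lambda^n,&\gamma=0,\\0,&\gamma\neq0.\end{cases}$$ *)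

theory Defs
  imports "HOL-Analysis.Analysis"
begin

definition real_vec :: "int ^ 'n \<Rightarrow> real ^ 'n" where
  "real_vec k = (\<chi> j. of_int (k $ j))"

text \<open>
  Functions on the torus are represented by functions on \<open>real ^ 'n\<close>. Trigonometric polynomials
  and masks are automatically \<open>2 * pi\<close>-periodic in each coordinate.
\<close>

definition trig_poly :: "(real ^ 'n \<Rightarrow> complex) \<Rightarrow> bool" where
  "trig_poly f \<longleftrightarrow> (\<exists>h :: int ^ 'n \<Rightarrow> complex. finite {k. h k \<noteq> 0} \<and>
     (\<forall>\<omega>. f \<omega> = (\<Sum>k | h k \<noteq> 0. h k * exp (- \<i> * of_real (real_vec k \<bullet> \<omega>)))))"

definition mask :: "(real ^ 'n \<Rightarrow> complex) \<Rightarrow> bool" where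
  "mask f \<longleftrightarrow> (\<exists>h :: int ^ 'n \<Rightarrow> real. finite {k. h k \<noteq> 0} \<and>
     (\<forall>\<omega>. f \<omega> = (\<Sum>k | h k \<noteq> 0. of_real (h k) * exp (- \<i> * of_real (real_vec k \<bullet> \<omega>)))))"

definition lowpass_mask :: "nat \<Rightarrow> (real ^ 'n \<Rightarrow> complex) \<Rightarrow> bool" where
  "lowpass_mask d \<tau> \<longleftrightarrow> mask \<tau> \<and> \<tau> 0 = of_real (real d powr (real CARD('n) / 2))"

definition wavelet_mask :: "(real ^ 'n \<Rightarrow> complex) \<Rightarrow> bool" where
  "wavelet_mask q \<longleftrightarrow> mask q \<and> q 0 = 0"

text \<open>\<open>R\<close> contains exactly one element of each coset of the subgroup \<open>H\<close> in the group \<open>G\<close>.\<close>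

definition complete_coset_reps :: "'a::ab_group_add set \<Rightarrow> 'a set \<Rightarrow> 'a set \<Rightarrow> bool" where
  "complete_coset_reps G H R \<longleftrightarrow> R \<subseteq> G \<and> (\<forall>x\<in>G. \<exists>!r. r \<in> R \<and> x - r \<in> H)"

definition dilated_int_lattice :: "nat \<Rightarrow> (int ^ 'n) set" where
  "dilated_int_lattice d = range (\<lambda>k. int d *s k)"

definition scaled_lattice :: "real \<Rightarrow> (real ^ 'n) set" where
  "scaled_lattice c = range (\<lambda>k. c *\<^sub>R real_vec k)"

text \<open>
  The wavelet masks form a list, not a set, because repeated masks must be counted with
  multiplicity in the sum. By periodicity the condition does not depend on the choice of the
  representatives \<open>\<Gamma>\<close> of the cosets of \<open>scaled_lattice (2 * pi)\<close> in
  \<open>scaled_lattice (2 * pi / d)\<close>.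
\<close>

definition tight_wavelet_filter_bank ::
  "nat \<Rightarrow> (real ^ 'n) set \<Rightarrow> (real ^ 'n \<Rightarrow> complex) \<Rightarrow> (real ^ 'n \<Rightarrow> complex) list \<Rightarrow> bool" where
  "tight_wavelet_filter_bank d \<Gamma> \<tau> qs \<longleftrightarrow>
     lowpass_mask d \<tau> \<and> (\<forall>q\<in>set qs. trig_poly q) \<and>
     (\<forall>\<omega>. \<forall>\<gamma>\<in>\<Gamma>.
        \<tau> \<omega> * cnj (\<tau> (\<omega> + \<gamma>)) + (\<Sum>q\<leftarrow>qs. q \<omega> * cnj (q (\<omega> + \<gamma>))) =
          (if \<gamma> = 0 then of_nat d ^ CARD('n) else 0))"

end

theory Submission
  imports Defs "HOL-Computational_Algebra.Fundamental_Theorem_Algebra"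
begin

text \<open>
  Take \<open>p l \<omega> = g (exp (\<i> * (\<xi> l \<bullet> \<omega>)))\<close>, where \<open>g\<close> is a real polynomial with \<open>g 1 = 1\<close> and
  \<open>\<bar>g z\<bar>\<^sup>2 = 1 - \<bar>(1 - z) / 2\<bar> ^ (2 * m l)\<close> on the unit circle, as given by the Fejer-Riesz
  factorisation. Under \<open>\<omega> \<mapsto> \<omega> + \<gamma>\<close> only the exponentials \<open>exp (\<i> * (\<nu> l \<bullet> \<omega>))\<close> change, so the choice
  of \<open>g\<close> makes all terms containing \<open>\<tau>\<close> cancel, and the filter bank condition becomes the
  orthogonality of characters of \<open>\<int>\<^sup>n / d \<int>\<^sup>n\<close>.
\<close>

section \<open>Masks\<close>

text \<open>The definition of \<open>mask\<close> sums over the exact support of \<open>h\<close>,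
  which is awkward to track when coefficients vanish or cancel. Setting \<open>h\<close> to zero
  outside \<open>A\<close> and discarding zero terms allows any finite index set.\<close>

lemma maskI:
  fixes h :: "int ^ 'n \<Rightarrow> real"
  assumes "finite A"
    and f: "\<And>\<omega>. f \<omega> = (\<Sum>k\<in>A. of_real (h k) * exp (- \<i> * of_real (real_vec k \<bullet> \<omega>)))"
  shows "mask f"
proof -
  define h' where "h' k = (if k \<in> A then h k else 0)" for k
  have sub: "{k. h' k \<noteq> 0} \<subseteq> A" by (auto simp: h'_def)
  have "f \<omega> = (\<Sum>k | h' k \<noteq> 0. of_real (h' k) * exp (- \<i> * of_real (real_vec k \<bullet> \<omega>)))" for \<omega>
  proof -
    have "f \<omega> = (\<Sum>k\<in>A. of_real (h' k) * exp (- \<i> * of_real (real_vec k \<bullet> \<omega>)))"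
      unfolding f by (rule sum.cong) (auto simp: h'_def)
    also have "\<dots> = (\<Sum>k | h' k \<noteq> 0. of_real (h' k) * exp (- \<i> * of_real (real_vec k \<bullet> \<omega>)))"
      using assms(1) sub by (intro sum.mono_neutral_right) auto
    finally show ?thesis .
  qed
  then show ?thesis
    unfolding mask_def using finite_subset[OF sub assms(1)] by blast
qed

lemma maskE:
  fixes f :: "real ^ 'n \<Rightarrow> complex"
  assumes "mask f"
  obtains A and h :: "int ^ 'n \<Rightarrow> real" where "finite A"
    and "f = (\<lambda>\<omega>. \<Sum>k\<in>A. of_real (h k) * exp (- \<i> * of_real (real_vec k \<bullet> \<omega>)))"
  using assms unfolding mask_def fun_eq_iff by blast

lemma trig_poly_mask:
  fixes f :: "real ^ 'n \<Rightarrow> complex"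
  assumes "mask f"
  shows "trig_poly f"
proof -
  obtain h :: "int ^ 'n \<Rightarrow> real" where h: "finite {k. h k \<noteq> 0}"
    "\<And>\<omega>. f \<omega> = (\<Sum>k | h k \<noteq> 0. of_real (h k) * exp (- \<i> * of_real (real_vec k \<bullet> \<omega>)))"
    using assms unfolding mask_def by blast
  then show ?thesis
    unfolding trig_poly_def by (intro exI[of _ "\<lambda>k. complex_of_real (h k)"]) auto
qed

lemma real_vec_add: "real_vec (k + l) = real_vec k + real_vec l"
  and real_vec_minus: "real_vec (- k) = - real_vec k"
  and real_vec_smult: "real_vec (a *s k) = of_int a *\<^sub>R real_vec k"
  and real_vec_0: "real_vec 0 = 0"
  by (simp_all add: real_vec_def vec_eq_iff)

lemma mask_monomial:
  "mask (\<lambda>\<omega>. of_real r * exp (- \<i> * of_real (real_vec k \<bullet> \<omega>)))"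
  by (rule maskI[of "{k}" _ "\<lambda>_. r"]) auto

lemma mask_exp: "mask (\<lambda>\<omega>. exp (\<i> * of_real (real_vec k \<bullet> \<omega>)))"
  using mask_monomial[of 1 "- k"] by (simp add: real_vec_minus)

lemma mask_of_real: "mask (\<lambda>\<omega>. of_real r)"
  using mask_monomial[of r 0] by (simp add: real_vec_0)

lemma mask_add:
  fixes f g :: "real ^ 'n \<Rightarrow> complex"
  assumes "mask f" "mask g"
  shows "mask (\<lambda>\<omega>. f \<omega> + g \<omega>)"
proof -
  obtain A h where A: "finite A"
    "f = (\<lambda>\<omega>. \<Sum>k\<in>A. of_real (h k) * exp (- \<i> * of_real (real_vec k \<bullet> \<omega>)))"
    using assms(1) by (rule maskE)
  obtain B h' where B: "finite B"
    "g = (\<lambda>\<omega>. \<Sum>k\<in>B. of_real (h' k) * exp (- \<i> * of_real (real_vec k \<bullet> \<omega>)))"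
    using assms(2) by (rule maskE)
  show ?thesis
  proof (rule maskI)
    show "finite (A \<union> B)" using A B by simp
    fix \<omega> :: "real ^ 'n"
    let ?e = "\<lambda>k. exp (- \<i> * of_real (real_vec k \<bullet> \<omega>))"
    have "f \<omega> = (\<Sum>k\<in>A \<union> B. (if k \<in> A then of_real (h k) * ?e k else 0))"
      unfolding A(2) using A(1) B(1) by (simp add: sum.If_cases Int_absorb1)
    moreover have "g \<omega> = (\<Sum>k\<in>A \<union> B. (if k \<in> B then of_real (h' k) * ?e k else 0))"
      unfolding B(2) using A(1) B(1) by (simp add: sum.If_cases Int_absorb1)
    ultimately show "f \<omega> + g \<omega> = (\<Sum>k\<in>A \<union> B. of_real
        ((if k \<in> A then h k else 0) + (if k \<in> B then h' k else 0)) * ?e k)"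
      by (auto simp: sum.distrib[symmetric] algebra_simps intro!: sum.cong)
  qed
qed

lemma mask_sum:
  assumes "\<And>i. i \<in> I \<Longrightarrow> mask (f i)"
  shows "mask (\<lambda>\<omega>. \<Sum>i\<in>I. f i \<omega>)"
  using assms
proof (induction I rule: infinite_finite_induct)
  case (insert i I)
  then show ?case by (simp add: mask_add)
qed (use mask_of_real[of 0] in auto)

text \<open>In the expanded double sum each term is again a real monomial, of frequency
  \<open>k + l\<close>. Closure under sums then finishes, without collecting equal frequencies into
  a convolution.\<close>

lemma mask_mult:
  fixes f g :: "real ^ 'n \<Rightarrow> complex"
  assumes "mask f" "mask g"
  shows "mask (\<lambda>\<omega>. f \<omega> * g \<omega>)"
proof -
  obtain A h where A: "f = (\<lambda>\<omega>. \<Sum>k\<in>A. of_real (h k) * exp (- \<i> * of_real (real_vec k \<bullet> \<omega>)))"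
    using assms(1) by (rule maskE)
  obtain B h' where B: "g = (\<lambda>\<omega>. \<Sum>k\<in>B. of_real (h' k) * exp (- \<i> * of_real (real_vec k \<bullet> \<omega>)))"
    using assms(2) by (rule maskE)
  have exp: "exp (- \<i> * of_real (real_vec (k + l) \<bullet> \<omega>)) =
      exp (- \<i> * of_real (real_vec k \<bullet> \<omega>)) * exp (- \<i> * of_real (real_vec l \<bullet> \<omega>))"
    for k l :: "int ^ 'n" and \<omega>
    by (simp only: real_vec_add inner_add_left of_real_add distrib_left exp_add)
  have "(\<lambda>\<omega>. f \<omega> * g \<omega>) = (\<lambda>\<omega>. \<Sum>k\<in>A. \<Sum>l\<in>B. of_real (h k * h' l) *
      exp (- \<i> * of_real (real_vec (k + l) \<bullet> \<omega>)))"
    unfolding A B sum_product by (intro ext sum.cong refl) (simp only: exp of_real_mult mult_ac)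
  then show ?thesis by (simp only: mask_sum mask_monomial)
qed

lemma mask_diff:
  assumes "mask f" "mask g"
  shows "mask (\<lambda>\<omega>. f \<omega> - g \<omega>)"
  using mask_add[OF assms(1) mask_mult[OF mask_of_real[of "-1"] assms(2)]] by simp

lemma mask_power: "mask f \<Longrightarrow> mask (\<lambda>\<omega>. f \<omega> ^ k)"
  by (induction k) (use mask_of_real[of 1] in \<open>auto intro: mask_mult\<close>)

text \<open>Real coefficients are fixed by conjugation, so only the frequencies change sign.\<close>

lemma mask_cnj:
  assumes "mask f"
  shows "mask (\<lambda>\<omega>. cnj (f \<omega>))"
proof -
  obtain A h where A: "f = (\<lambda>\<omega>. \<Sum>k\<in>A. of_real (h k) * exp (- \<i> * of_real (real_vec k \<bullet> \<omega>)))"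
    using assms by (rule maskE)
  have "(\<lambda>\<omega>. cnj (f \<omega>)) = (\<lambda>\<omega>. \<Sum>k\<in>A. of_real (h k) *
      exp (\<i> * of_real (real_vec k \<bullet> \<omega>)))"
    unfolding A by (simp add: exp_cnj)
  then show ?thesis by (simp only: mask_sum mask_mult mask_exp mask_of_real)
qed

text \<open>Masks must have real coefficients; this is why the Fejer-Riesz factor below is sought
  among real polynomials.\<close>

lemma mask_poly:
  fixes g :: "real poly"
  assumes "mask f"
  shows "mask (\<lambda>\<omega>. poly (map_poly of_real g) (f \<omega>))"
  unfolding poly_altdef
  by (simp add: coeff_map_poly mask_sum mask_mult mask_of_real mask_power assms)

section \<open>Fejer-Riesz factorisation\<close>

text \<open>
  With \<open>z = exp (\<i> t)\<close> one has \<open>x := (1 - cos t) / 2 = (2 - z - 1 / z) / 4\<close>, so \<open>-4 * z * (x - x0)\<close> is a quadratic in \<open>z\<close>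
  with roots \<open>a\<close> and \<open>1 / a\<close>; on the unit circle \<open>\<bar>z - 1 / a\<bar> = \<bar>z - cnj a\<bar> / \<bar>a\<bar>\<close>.
\<close>

lemma norm_half_one_minus_cos_diff:
  fixes x0 a :: complex
  assumes a: "a\<^sup>2 - (2 - 4 * x0) * a + 1 = 0"
  shows "4 * norm a * norm (of_real ((1 - cos t) / 2) - x0) =
    norm (exp (\<i> * of_real t) - a) * norm (exp (\<i> * of_real t) - cnj a)"
proof -
  define z where "z = exp (\<i> * of_real t)"
  have nz: "norm z = 1" by (simp add: z_def)
  have zz: "z * cnj z = 1" by (simp add: complex_norm_square[symmetric] nz)
  have "z + cnj z = 2 * of_real (cos t)"
    by (simp add: z_def complex_add_cnj Re_exp)
  then have c: "of_real (cos t) = (z + cnj z) / 2" by simp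
  have x0: "4 * a * x0 = - 1 + 2 * a - a\<^sup>2" using a by (simp add: algebra_simps)
  have "4 * a * (of_real ((1 - cos t) / 2) - x0) = a * (2 - z - cnj z) - 4 * a * x0"
    by (simp add: c field_simps)
  also have "\<dots> = (z - a) * (cnj z * 1 - a * 1) - a * z + z * a + (1 - z * cnj z)"
    unfolding x0 by (simp add: algebra_simps power2_eq_square)
  also have "\<dots> = (z - a) * cnj (z - cnj a)" by (simp add: zz)
  finally have "norm (4 * a * (of_real ((1 - cos t) / 2) - x0)) = norm ((z - a) * cnj (z - cnj a))"
    by simp
  then show ?thesis
    unfolding norm_mult complex_mod_cnj z_def by simp
qed

lemma complex_poly_of_real:
  "poly (map_poly of_real q) (of_real x :: complex) = of_real (poly q x)" for q :: "real poly"
  by (simp add: poly_altdef coeff_map_poly degree_map_poly)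

lemma map_poly_of_real_mult:
  "map_poly of_real (p * q) = (map_poly of_real p * map_poly of_real q :: complex poly)"
  for p q :: "real poly"
  by (rule poly_eqI) (simp add: coeff_map_poly coeff_mult)

lemma map_poly_of_real_add:
  "map_poly of_real (p + q) = (map_poly of_real p + map_poly of_real q :: complex poly)"
  for p q :: "real poly"
  by (rule poly_eqI) (simp add: coeff_map_poly)

text \<open>The quadratic is (X - w) (X - cnj w). The remainder of \<open>q\<close> modulo it is
  real, of degree at most 1, and still vanishes at \<open>w\<close>; since \<open>w\<close> is not
  real, both of its coefficients are 0.\<close>

lemma nonreal_root_dvd:
  fixes q :: "real poly" and w :: complex
  assumes root: "poly (map_poly of_real q) w = 0" and im: "Im w \<noteq> 0"
  shows "[:(norm w)\<^sup>2, - 2 * Re w, 1:] dvd q"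
proof -
  define Q where "Q = [:(norm w)\<^sup>2, - 2 * Re w, 1:]"
  define r where "r = q mod Q"
  have degQ: "degree Q = 2" by (simp add: Q_def)
  then have "Q \<noteq> 0" by auto
  have "degree r < 2"
    using degree_mod_less'[OF \<open>Q \<noteq> 0\<close>, of q] degQ by (cases "r = 0") (auto simp: r_def)
  then have r: "r = [:coeff r 0, coeff r 1:]"
    by (intro poly_eqI) (auto simp: coeff_pCons coeff_eq_0 split: nat.split)
  have "poly (map_poly of_real Q) w = of_real ((norm w)\<^sup>2) - w * (of_real (2 * Re w) - w)"
    by (simp add: Q_def map_poly_pCons algebra_simps)
  also have "\<dots> = 0"
    unfolding cmod_power2 by (simp add: complex_eq_iff power2_eq_square algebra_simps)
  finally have Qw: "poly (map_poly of_real Q) w = 0" .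
  have "q = q div Q * Q + r" by (simp add: r_def)
  then have "poly (map_poly of_real r) w = 0"
    using root Qw by (metis add.left_neutral map_poly_of_real_add map_poly_of_real_mult
        mult_zero_right poly_add poly_mult)
  then have "of_real (coeff r 0) + w * of_real (coeff r 1) = 0"
    by (subst (asm) r) (simp add: map_poly_pCons)
  then have "coeff r 1 = 0" "coeff r 0 = 0"
    using im by (auto simp: complex_eq_iff)
  then have "r = 0" by (subst r) simp
  then show ?thesis by (simp add: r_def Q_def mod_eq_0_iff_dvd)
qed

text \<open>Induction on the degree: a complex root of \<open>q\<close> yields a real linear or
  quadratic factor, for which the spectral factor is explicit. Absolute values make both sides
  multiplicative, so the signs of the factors need not be tracked.\<close>

lemma fejer_riesz_cos:
  fixes q :: "real poly"
  assumes "q \<noteq> 0" "\<And>x. 0 < x \<Longrightarrow> x < 1 \<Longrightarrow> poly q x \<noteq> 0"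
  shows "\<exists>g :: real poly. \<forall>t. \<bar>poly q ((1 - cos t) / 2)\<bar> =
    (norm (poly (map_poly of_real g) (exp (\<i> * of_real t))))\<^sup>2"
  using assms
proof (induction "degree q" arbitrary: q rule: less_induct)
  case less
  \<comment> \<open>It suffices to split off a nonconstant factor \<open>Q\<close> with a spectral
    factor \<open>k\<close> of its own: the induction hypothesis treats the cofactor
    \<open>s\<close>, and the two factors are multiplied.\<close>
  have step: ?case
    if q: "q = Q * s" and Q: "degree Q > 0"
      and k: "\<forall>t. \<bar>poly Q ((1 - cos t) / 2)\<bar> =
        (norm (poly (map_poly of_real k) (exp (\<i> * of_real t))))\<^sup>2" for Q s k :: "real poly"
  proof -
    have "s \<noteq> 0" "Q \<noteq> 0" using less.prems(1) q by auto
    then have "degree s < degree q" using Q by (simp add: q degree_mult_eq)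
    moreover have "poly s x \<noteq> 0" if "0 < x" "x < 1" for x
      using less.prems(2)[OF that] by (simp add: q)
    ultimately obtain g where g: "\<forall>t. \<bar>poly s ((1 - cos t) / 2)\<bar> =
        (norm (poly (map_poly of_real g) (exp (\<i> * of_real t))))\<^sup>2"
      using less.hyps \<open>s \<noteq> 0\<close> by blast
    show ?case
      using k g by (intro exI[of _ "k * g"])
        (simp add: q abs_mult map_poly_of_real_mult norm_mult power_mult_distrib)
  qed
  show ?case
  proof (cases "degree q = 0")
    case True
    then obtain c where "q = [:c:]" by (rule degree_eq_zeroE)
    then show ?thesis
      by (intro exI[of _ "[:sqrt \<bar>c\<bar>:]"]) (simp add: map_poly_pCons)
  next
    case False
    then have "degree (map_poly of_real q :: complex poly) \<noteq> 0"
      by (simp add: degree_map_poly)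
    then obtain w :: complex where w: "poly (map_poly of_real q) w = 0"
      using fundamental_theorem_of_algebra_alt[of "map_poly of_real q"] by force
    show ?thesis
    proof (cases "Im w = 0")
      case True
      define r where "r = Re w"
      have wr: "w = of_real r" using True by (simp add: r_def complex_eq_iff)
      have r0: "poly q r = 0" using w unfolding wr complex_poly_of_real by simp
      \<comment> \<open>A real root outside the open unit interval gives the quadratic for
        \<open>a\<close> a nonnegative discriminant, so \<open>a\<close> is real and so is
        \<open>k\<close>.\<close>
      then have "r \<le> 0 \<or> 1 \<le> r" using less.prems(2)[of r] by force
      then have disc: "r\<^sup>2 - r \<ge> 0"
        by (auto simp: power2_eq_square intro: mult_left_mono[of 1 r r, simplified]
            order_trans[of r 0 "r * r"])
      define a where "a = 1 - 2 * r + 2 * sqrt (r\<^sup>2 - r)"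
      have "(a - (1 - 2 * r))\<^sup>2 = 4 * (r\<^sup>2 - r)"
        using disc by (simp add: a_def power_mult_distrib)
      then have a: "a\<^sup>2 - (2 - 4 * r) * a + 1 = 0"
        by (simp add: power2_eq_square algebra_simps)
      then have "a \<noteq> 0" by auto
      obtain s where s: "q = [:- r, 1:] * s" using r0 by (auto simp: poly_eq_0_iff_dvd dvd_def)
      have "complex_of_real (a\<^sup>2 - (2 - 4 * r) * a + 1) = 0" using a by simp
      then have ac: "(of_real a)\<^sup>2 - (2 - 4 * w) * of_real a + 1 = 0" by (simp add: wr)
      \<comment> \<open>For real \<open>a\<close> the factors with \<open>a\<close> and
        \<open>cnj a\<close> coincide, so the distance from x to \<open>r\<close> is the square of
        the norm of z - \<open>a\<close> divided by 4 times the modulus of \<open>a\<close>.\<close>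
      define k where "k = smult (1 / (2 * sqrt \<bar>a\<bar>)) [:- a, 1:]"
      have "\<bar>poly [:- r, 1:] ((1 - cos t) / 2)\<bar> =
          (norm (poly (map_poly of_real k) (exp (\<i> * of_real t))))\<^sup>2" for t
      proof -
        have "\<bar>poly [:- r, 1:] ((1 - cos t) / 2)\<bar> = norm (of_real ((1 - cos t) / 2) - w)"
          unfolding wr of_real_diff[symmetric] norm_of_real by simp
        also have "\<dots> = (norm (exp (\<i> * of_real t) - of_real a))\<^sup>2 / (4 * \<bar>a\<bar>)"
          using norm_half_one_minus_cos_diff[OF ac, of t] \<open>a \<noteq> 0\<close>
          by (simp add: field_simps power2_eq_square)
        also have "\<dots> = (norm (poly (map_poly of_real k) (exp (\<i> * of_real t))))\<^sup>2"
          by (simp add: k_def map_poly_pCons norm_mult norm_divide power_mult_distrib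
              power_divide diff_divide_distrib[symmetric])
        finally show ?thesis .
      qed
      then show ?thesis by (intro step[OF s, of k]) auto
    next
      case False
      obtain s where s: "q = [:(norm w)\<^sup>2, - 2 * Re w, 1:] * s"
        using nonreal_root_dvd[OF w False] by (auto simp: dvd_def)
      \<comment> \<open>\<open>b\<close> is half the sum of the roots of the quadratic for
        \<open>a\<close>, whose product is 1. The quadratic factor of \<open>q\<close> is the
        squared distance from x to \<open>w\<close>, so here a real \<open>k\<close> with roots
        \<open>a\<close> and \<open>cnj a\<close> is needed, scaled by
        \<open>1 / (4 * norm a)\<close>.\<close>
      define b where "b = 1 - 2 * w"
      define a where "a = b + csqrt (b\<^sup>2 - 1)"
      have "(a - b)\<^sup>2 = b\<^sup>2 - 1" by (simp add: a_def)
      then have a: "a\<^sup>2 - (2 - 4 * w) * a + 1 = 0"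
        by (simp add: power2_eq_square algebra_simps b_def)
      then have "a \<noteq> 0" by auto
      define k where "k = smult (1 / (4 * norm a)) [:(norm a)\<^sup>2, - 2 * Re a, 1:]"
      have quad: "of_real ((norm u)\<^sup>2) + z * (z - of_real (2 * Re u)) = (z - u) * (z - cnj u)"
        for u z :: complex
        unfolding cmod_power2 by (simp add: complex_eq_iff power2_eq_square algebra_simps)
      have "\<bar>poly [:(norm w)\<^sup>2, - 2 * Re w, 1:] ((1 - cos t) / 2)\<bar> =
          (norm (poly (map_poly of_real k) (exp (\<i> * of_real t))))\<^sup>2" for t
      proof -
        define x where "x = (1 - cos t) / 2"
        define z where "z = exp (\<i> * of_real t)"
        have "poly [:(norm w)\<^sup>2, - 2 * Re w, 1:] x = (x - Re w)\<^sup>2 + (Im w)\<^sup>2"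
          unfolding cmod_power2 by (simp add: power2_eq_square algebra_simps)
        also have "\<dots> = (norm (of_real x - w))\<^sup>2" by (simp add: cmod_power2)
        finally have 1: "\<bar>poly [:(norm w)\<^sup>2, - 2 * Re w, 1:] x\<bar> = (norm (of_real x - w))\<^sup>2" by simp
        have "norm (of_real x - w) * (4 * norm a) = norm ((z - a) * (z - cnj a))"
          using norm_half_one_minus_cos_diff[OF a, of t]
          by (simp only: x_def z_def norm_mult mult_ac)
        then have 2: "norm (of_real x - w) = norm ((z - a) * (z - cnj a)) / (4 * norm a)"
          using \<open>a \<noteq> 0\<close> by (intro eq_divide_imp) simp
        have "poly (map_poly of_real k) z =
            (of_real ((norm a)\<^sup>2) + z * (z - of_real (2 * Re a))) / of_real (4 * norm a)"
          using \<open>a \<noteq> 0\<close> by (simp add: k_def map_poly_pCons field_simps)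
        then have 3: "norm (poly (map_poly of_real k) z) = norm ((z - a) * (z - cnj a)) / (4 * norm a)"
          unfolding quad by (simp add: norm_divide)
        show ?thesis using 1 2 3 by (simp add: x_def z_def)
      qed
      then show ?thesis by (intro step[OF s, of k]) auto
    qed
  qed
qed

text \<open>Fejer-Riesz is applied to 1 - x^k, which has no zero strictly between 0 and 1. With k =
  \<open>m l\<close> the resulting filter complements the normalised difference factor in
  \<open>qD\<close>.\<close>

lemma complementary_filter:
  fixes k :: nat
  assumes "k > 0"
  obtains g :: "real poly" where "poly g 1 = 1"
    and "\<And>t. (norm (poly (map_poly of_real g) (exp (\<i> * of_real t))))\<^sup>2 = 1 - ((1 - cos t) / 2) ^ k"
proof -
  define q where "q = 1 - monom (1 :: real) k"
  have q: "poly q x = 1 - x ^ k" for x by (simp add: q_def poly_monom)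
  have "poly q 0 \<noteq> 0" using assms by (simp add: q zero_power)
  then have "q \<noteq> 0" by auto
  moreover have "poly q x \<noteq> 0" if "0 < x" "x < 1" for x
    using power_Suc_less_one[of x "k - 1"] that assms by (simp add: q)
  ultimately obtain g where g: "\<And>t. \<bar>poly q ((1 - cos t) / 2)\<bar> =
      (norm (poly (map_poly of_real g) (exp (\<i> * of_real t))))\<^sup>2"
    using fejer_riesz_cos by blast
  have "1 = (norm (poly (map_poly of_real g) (complex_of_real 1)))\<^sup>2"
    using g[of 0] assms by (simp add: q zero_power)
  then have g1: "(poly g 1)\<^sup>2 = 1"
    unfolding complex_poly_of_real by simp
  \<comment> \<open>As \<open>poly g 1\<close> is 1 or -1, this corrects the sign at 1 without
    changing any norm.\<close>
  define G where "G = smult (poly g 1) g"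
  have G: "map_poly of_real G = smult (of_real (poly g 1)) (map_poly of_real g :: complex poly)"
    by (rule poly_eqI) (simp add: G_def coeff_map_poly)
  show ?thesis
  proof
    show "poly G 1 = 1" using g1 by (simp add: G_def power2_eq_square)
    fix t :: real
    have "((1 - cos t) / 2) ^ k \<le> 1" 
      using cos_ge_minus_one[of t] cos_le_one[of t] by (intro power_le_one) simp_all
    then show "(norm (poly (map_poly of_real G) (exp (\<i> * of_real t))))\<^sup>2 = 1 - ((1 - cos t) / 2) ^ k"
      using g[of t] g1 by (simp add: G norm_mult power_mult_distrib q)
  qed
qed

section \<open>Orthogonality of characters\<close>

text \<open>Translation by \<open>k\<close> permutes the cosets and \<open>f\<close> is constant on
  each coset, so the sum equals itself times \<open>f k\<close>, which is not 1.\<close>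

lemma sum_character_coset_reps:
  fixes f :: "'a::ab_group_add \<Rightarrow> complex"
  assumes reps: "complete_coset_reps UNIV H R" and fin: "finite R"
    and H: "0 \<in> H" "\<And>x y. x \<in> H \<Longrightarrow> y \<in> H \<Longrightarrow> x - y \<in> H"
    and hom: "\<And>x y. f (x + y) = f x * f y" and triv: "\<And>x. x \<in> H \<Longrightarrow> f x = 1"
    and k: "f k \<noteq> 1"
  shows "(\<Sum>r\<in>R. f r) = 0"
proof -
  have ex1: "\<exists>!r. r \<in> R \<and> x - r \<in> H" for x
    using reps by (simp add: complete_coset_reps_def)
  then obtain rep where rep: "\<And>x. rep x \<in> R" "\<And>x. x - rep x \<in> H" by metis
  have f_rep: "f (rep x) = f x" for x
    using hom[of "x - rep x" "rep x"] triv[OF rep(2)] by simp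
  have inj: "inj_on (\<lambda>r. rep (r + k)) R"
  proof
    fix r s assume rs: "r \<in> R" "s \<in> R" "rep (r + k) = rep (s + k)"
    then have "(r + k - rep (r + k)) - (s + k - rep (r + k)) \<in> H"
      using H(2) rep(2) by metis
    then have "r - s \<in> H" by simp
    moreover have "r - r \<in> H" using H(1) by simp
    ultimately show "r = s" using ex1 rs by metis
  qed
  have "bij_betw (\<lambda>r. rep (r + k)) R R"
    using endo_inj_surj[OF fin _ inj] inj rep(1) by (auto simp: bij_betw_def)
  then have "(\<Sum>r\<in>R. f r) = (\<Sum>r\<in>R. f (rep (r + k)))"
    by (rule sum.reindex_bij_betw[symmetric])
  also have "\<dots> = (\<Sum>r\<in>R. f r) * f k" by (simp add: f_rep hom sum_distrib_right)
  finally show ?thesis using k by simp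
qed

lemma exp_real_vec_eq_1:
  "exp (\<i> * of_real (real_vec k \<bullet> ((2 * pi) *\<^sub>R real_vec l))) = 1"
proof -
  have "real_vec k \<bullet> real_vec l = of_int (\<Sum>i\<in>UNIV. k $ i * l $ i)"
    by (simp add: real_vec_def inner_vec_def)
  then obtain n where "real_vec k \<bullet> real_vec l = of_int n" by blast
  then show ?thesis
    by (auto simp: exp_eq_1)
qed

text \<open>If every integer character were 1 at \<gamma>, testing the unit vectors would make each
  coordinate of \<gamma> a multiple of 2 pi.\<close>

lemma ex_character_ne_1:
  fixes \<gamma> :: "real ^ 'n"
  assumes "\<gamma> \<notin> scaled_lattice (2 * pi)"
  shows "\<exists>k. exp (\<i> * of_real (real_vec k \<bullet> \<gamma>)) \<noteq> 1"
proof (rule ccontr)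
  assume *: "\<not> ?thesis"
  have "\<exists>n. \<gamma> $ j = 2 * pi * of_int n" for j
  proof -
    have "real_vec (axis j 1) = axis j (1 :: real)"
      by (simp add: real_vec_def axis_def vec_eq_iff)
    then have "exp (\<i> * of_real (\<gamma> $ j)) = 1"
      using * by (metis inner_axis' inner_real_def mult_1)
    then show ?thesis by (auto simp: exp_eq_1)
  qed
  then obtain n where "\<And>j. \<gamma> $ j = 2 * pi * of_int (n j)" by metis
  then have "\<gamma> = (2 * pi) *\<^sub>R real_vec (\<chi> j. n j)" by (simp add: vec_eq_iff real_vec_def)
  then show False using assms by (auto simp: scaled_lattice_def)
qed

text \<open>The character given by \<gamma> is trivial on the sublattice because \<open>d\<close>
  times \<gamma> lies in the 2 pi lattice, and nontrivial overall because \<gamma> itself does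
  not.\<close>

lemma sum_exp_coset_reps:
  fixes \<gamma> :: "real ^ 'n" and R :: "(int ^ 'n) set"
  assumes reps: "complete_coset_reps UNIV (dilated_int_lattice d) R" and "finite R"
    and d: "d > 0" and \<gamma>: "\<gamma> \<in> scaled_lattice (2 * pi / real d)" "\<gamma> \<notin> scaled_lattice (2 * pi)"
  shows "(\<Sum>k\<in>R. exp (\<i> * of_real (real_vec k \<bullet> \<gamma>))) = 0"
proof -
  obtain l where l: "\<gamma> = (2 * pi / real d) *\<^sub>R real_vec l"
    using \<gamma>(1) by (auto simp: scaled_lattice_def)
  obtain k where k: "exp (\<i> * of_real (real_vec k \<bullet> \<gamma>)) \<noteq> 1"
    using ex_character_ne_1[OF \<gamma>(2)] by blast
  show ?thesis
  proof (rule sum_character_coset_reps[OF reps \<open>finite R\<close>, where k = k])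
    show "0 \<in> dilated_int_lattice d"
      unfolding dilated_int_lattice_def by (rule range_eqI[where x = 0]) simp
    fix x y :: "int ^ 'n"
    show "x - y \<in> dilated_int_lattice d" if xy: "x \<in> dilated_int_lattice d" "y \<in> dilated_int_lattice d"
    proof -
      obtain a where "x = int d *s a"
        using xy(1) unfolding dilated_int_lattice_def by blast
      moreover obtain b where "y = int d *s b"
        using xy(2) unfolding dilated_int_lattice_def by blast
      ultimately have "x - y = int d *s (a - b)" by (simp add: vector_ssub_ldistrib)
      then show ?thesis unfolding dilated_int_lattice_def by (rule range_eqI)
    qed
    show "exp (\<i> * of_real (real_vec (x + y) \<bullet> \<gamma>)) =
        exp (\<i> * of_real (real_vec x \<bullet> \<gamma>)) * exp (\<i> * of_real (real_vec y \<bullet> \<gamma>))"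
      by (simp add: real_vec_add inner_add_left distrib_left exp_add)
    show "exp (\<i> * of_real (real_vec x \<bullet> \<gamma>)) = 1" if x: "x \<in> dilated_int_lattice d"
    proof -
      obtain z where "x = int d *s z" using x by (auto simp: dilated_int_lattice_def)
      then have "real_vec x \<bullet> \<gamma> = real_vec z \<bullet> ((2 * pi) *\<^sub>R real_vec l)"
        using d by (simp add: l real_vec_smult)
      then show ?thesis by (simp only: exp_real_vec_eq_1)
    qed
  qed (fact k)
qed

section \<open>The filter bank\<close>

text \<open>Primed quantities stand for values at the shifted point; \<open>P\<close> and
  \<open>D\<close> carry no prime because they are invariant under the shift. By \<open>PD\<close>
  and \<open>I\<close> the quadratic terms of the last two sums add up to
  \<open>\<tau> * cnj \<tau>'\<close>, and so does the leading product; the two mixed terms each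
  remove one copy.\<close>

lemma tight_filter_bank_identity:
  fixes P D e e' :: "'a \<Rightarrow> complex" and c :: real and \<tau> \<tau>' :: complex
  assumes I: "c\<^sup>2 * real (card I) = 1"
    and PD: "\<And>i. i \<in> I \<Longrightarrow> (norm (D i))\<^sup>2 + (norm (P i))\<^sup>2 = 1"
    and \<tau>: "\<tau> = c * (\<Sum>i\<in>I. P i * e i)" and \<tau>': "\<tau>' = c * (\<Sum>i\<in>I. P i * e' i)"
  shows "\<tau> * cnj \<tau>' + ((\<Sum>i\<in>I. (c * D i * \<tau>) * cnj (c * D i * \<tau>')) +
      (\<Sum>i\<in>I. (e i - c * \<tau> * cnj (P i)) * cnj (e' i - c * \<tau>' * cnj (P i)))) =
    (\<Sum>i\<in>I. e i * cnj (e' i))"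
proof -
  have termwise: "(c * D i * \<tau>) * cnj (c * D i * \<tau>') +
      (e i - c * \<tau> * cnj (P i)) * cnj (e' i - c * \<tau>' * cnj (P i)) =
      e i * cnj (e' i) + c\<^sup>2 * (\<tau> * cnj \<tau>') - \<tau> * (c * cnj (P i * e' i)) - cnj \<tau>' * (c * (P i * e i))"
    if "i \<in> I" for i
  proof -
    have "of_real ((norm (D i))\<^sup>2 + (norm (P i))\<^sup>2) = complex_of_real 1" using PD[OF that] by simp
    then have *: "D i * cnj (D i) + P i * cnj (P i) = 1"
      by (simp only: complex_norm_square of_real_add of_real_1)
    have "(c * D i * \<tau>) * cnj (c * D i * \<tau>') +
      (e i - c * \<tau> * cnj (P i)) * cnj (e' i - c * \<tau>' * cnj (P i)) =
      e i * cnj (e' i) + c\<^sup>2 * (\<tau> * cnj \<tau>') * (D i * cnj (D i) + P i * cnj (P i))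
        - \<tau> * (c * cnj (P i * e' i)) - cnj \<tau>' * (c * (P i * e i))"
      by (simp add: algebra_simps power2_eq_square)
    then show ?thesis by (simp only: * mult_1_right)
  qed
  have "(\<Sum>i\<in>I. (c * D i * \<tau>) * cnj (c * D i * \<tau>')) +
      (\<Sum>i\<in>I. (e i - c * \<tau> * cnj (P i)) * cnj (e' i - c * \<tau>' * cnj (P i))) =
    (\<Sum>i\<in>I. e i * cnj (e' i) + c\<^sup>2 * (\<tau> * cnj \<tau>') - \<tau> * (c * cnj (P i * e' i))
      - cnj \<tau>' * (c * (P i * e i)))"
    unfolding sum.distrib[symmetric] by (rule sum.cong) (simp_all only: termwise)
  also have "\<dots> = (\<Sum>i\<in>I. e i * cnj (e' i)) + of_real (c\<^sup>2 * real (card I)) * (\<tau> * cnj \<tau>')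
      - \<tau> * (c * cnj (\<Sum>i\<in>I. P i * e' i)) - cnj \<tau>' * (c * (\<Sum>i\<in>I. P i * e i))"
    by (simp add: sum.distrib sum_subtractf sum_distrib_left mult.assoc)
  also have "\<dots> = (\<Sum>i\<in>I. e i * cnj (e' i)) + \<tau> * cnj \<tau>' - \<tau> * cnj \<tau>' - cnj \<tau>' * \<tau>"
    unfolding I by (simp add: \<tau> \<tau>')
  finally show ?thesis by simp
qed

text \<open>The squared distance from 1 to a point at angle t on the unit circle is 2 - 2 cos t. The
  result is the quantity subtracted from 1 in \<open>complementary_filter\<close>.\<close>

lemma norm_half_one_minus_exp_power:
  "(norm ((1 / 2 ^ k) * (1 - exp (- \<i> * of_real t)) ^ k))\<^sup>2 = ((1 - cos t) / 2) ^ k"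
proof -
  have "(norm (1 - exp (- \<i> * of_real t)))\<^sup>2 = 1 - 2 * cos t + ((cos t)\<^sup>2 + (sin t)\<^sup>2)"
    unfolding cmod_power2 by (simp add: Re_exp Im_exp power2_eq_square algebra_simps)
  then have "(norm (1 - exp (- \<i> * of_real t)))\<^sup>2 = 4 * ((1 - cos t) / 2)" by simp
  then have "((norm (1 - exp (- \<i> * of_real t)))\<^sup>2) ^ k = 4 ^ k * ((1 - cos t) / 2) ^ k"
    by (simp only: power_mult_distrib)
  moreover have "(2 ^ k)\<^sup>2 = (4 :: real) ^ k"
    by (simp add: power_mult[symmetric] mult.commute[of k] power_mult)
  ultimately show ?thesis
    by (simp add: norm_mult norm_divide norm_power power_divide power_commutes
        power_mult_distrib power_mult[symmetric] mult.commute)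
qed

theorem theorem3p1:
  fixes N d :: nat
    and \<xi> \<nu> :: "nat \<Rightarrow> int ^ 'n"
    and m :: "nat \<Rightarrow> nat"
    and \<Lambda> :: "(int ^ 'n) set"
    and \<Gamma> :: "(real ^ 'n) set"
  assumes "CARD('n) \<ge> 2"
    and "N \<ge> 1"
    and "\<forall>l\<in>{1..N}. m l > 0"
    and "d \<ge> 2"
    and "N \<le> d ^ CARD('n)"
    and "complete_coset_reps UNIV (dilated_int_lattice d) \<Lambda>"
    and "0 \<in> \<Lambda>"
    and "bij_betw \<nu> {1..d ^ CARD('n)} \<Lambda>"
    and "complete_coset_reps (scaled_lattice (2 * pi / real d)) (scaled_lattice (2 * pi)) \<Gamma>"
    and "0 \<in> \<Gamma>"
  shows "\<exists>p :: nat \<Rightarrow> real ^ 'n \<Rightarrow> complex.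
    (\<forall>l\<in>{1..N}. trig_poly (p l)) \<and>
    (let c = complex_of_real (real d powr (- (real CARD('n) / 2)));
         \<tau> = (\<lambda>\<omega>. (\<Sum>l=1..N. c * p l (real d *\<^sub>R \<omega>) * exp (\<i> * of_real (real_vec (\<nu> l) \<bullet> \<omega>)))
                 + (\<Sum>l=N+1..d ^ CARD('n). c * exp (\<i> * of_real (real_vec (\<nu> l) \<bullet> \<omega>))));
         qD = (\<lambda>l \<omega>. c * (1 / 2 ^ m l) *
                 (1 - exp (- \<i> * of_real (real d * (real_vec (\<xi> l) \<bullet> \<omega>)))) ^ m l * \<tau> \<omega>);
         qC = (\<lambda>\<mu> \<omega>. if \<mu> \<le> N
                 then exp (\<i> * of_real (real_vec (\<nu> \<mu>) \<bullet> \<omega>)) - c * \<tau> \<omega> * cnj (p \<mu> (real d *\<^sub>R \<omega>))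
                 else exp (\<i> * of_real (real_vec (\<nu> \<mu>) \<bullet> \<omega>)) - c * \<tau> \<omega>)
     in lowpass_mask d \<tau> \<and>
        (\<forall>l\<in>{1..N}. wavelet_mask (qD l)) \<and>
        (\<forall>\<mu>\<in>{1..d ^ CARD('n)}. wavelet_mask (qC \<mu>)) \<and>
        tight_wavelet_filter_bank d \<Gamma> \<tau>
          (map qD [1..<N + 1] @ map qC [1..<d ^ CARD('n) + 1]))"
proof -

  \<comment> \<open>Normalisation constants\<close>
  define M where "M = d ^ CARD('n)"
  define cr where "cr = real d powr (- (real CARD('n) / 2))"
  define c where "c = complex_of_real cr"
  have dM: "real d ^ CARD('n) = real M" by (simp add: M_def)
  have M: "N \<le> M" using assms(5) by (simp add: M_def)
  have d0: "d > 0" using assms(4) by simp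
  have "cr\<^sup>2 = real d powr (- real CARD('n))"
    unfolding cr_def power2_eq_square powr_add[symmetric] by simp
  then have crM: "cr\<^sup>2 * real M = 1"
    using d0 by (simp add: powr_minus powr_realpow dM[symmetric])
  have "cr * real M = real d powr (real CARD('n) / 2)"
    unfolding cr_def dM[symmetric] using d0
    by (subst powr_realpow[symmetric], simp, subst powr_add[symmetric]) simp
  then have cM: "c * of_nat M = of_real (real d powr (real CARD('n) / 2))"
    unfolding c_def by (metis of_real_mult of_real_of_nat_eq)
  have ccM: "c * (c * of_nat M) = 1"
    using crM by (metis c_def mult.assoc of_real_1 of_real_mult of_real_of_nat_eq power2_eq_square)

  \<comment> \<open>Choice of the trigonometric polynomials and of the filters\<close>
  have "\<forall>l\<in>{1..N}. \<exists>g :: real poly. poly g 1 = 1 \<and>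
      (\<forall>t. (norm (poly (map_poly of_real g) (exp (\<i> * of_real t))))\<^sup>2 = 1 - ((1 - cos t) / 2) ^ m l)"
    using complementary_filter assms(3) by metis
  then obtain g :: "nat \<Rightarrow> real poly" where g1: "\<And>l. l \<in> {1..N} \<Longrightarrow> poly (g l) 1 = 1"
    and g: "\<And>l t. l \<in> {1..N} \<Longrightarrow> (norm (poly (map_poly of_real (g l)) (exp (\<i> * of_real t))))\<^sup>2 =
      1 - ((1 - cos t) / 2) ^ m l"
    by metis
  define p where "p l \<omega> = poly (map_poly of_real (g l)) (exp (\<i> * of_real (real_vec (\<xi> l) \<bullet> \<omega>)))"
    for l and \<omega> :: "real ^ 'n"
  define e where "e l \<omega> = exp (\<i> * of_real (real_vec (\<nu> l) \<bullet> \<omega>))" for l and \<omega> :: "real ^ 'n"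
  define E where "E l \<omega> = exp (\<i> * of_real (real d * (real_vec (\<xi> l) \<bullet> \<omega>)))"
    for l and \<omega> :: "real ^ 'n"
  define E' where "E' l \<omega> = exp (- \<i> * of_real (real d * (real_vec (\<xi> l) \<bullet> \<omega>)))"
    for l and \<omega> :: "real ^ 'n"
  \<comment> \<open>Padding with \<open>P\<close> = 1 and \<open>D\<close> = 0 above
    \<open>N\<close> lets all sums run over \<open>{1..M}\<close> and keeps the squared norms of
    \<open>P\<close> and \<open>D\<close> summing to 1.\<close>
  define P where "P l \<omega> = (if l \<le> N then p l (real d *\<^sub>R \<omega>) else 1)" for l \<omega>
  define D where "D l \<omega> = (if l \<le> N then (1 / 2 ^ m l) * (1 - E' l \<omega>) ^ m l else 0)" for l \<omega>
  define \<tau> where "\<tau> \<omega> = c * (\<Sum>l=1..M. P l \<omega> * e l \<omega>)" for \<omega>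
  define qD where "qD l \<omega> = c * (1 / 2 ^ m l) * (1 - E' l \<omega>) ^ m l * \<tau> \<omega>" for l \<omega>
  define qC where "qC \<mu> \<omega> = e \<mu> \<omega> - c * \<tau> \<omega> * cnj (P \<mu> \<omega>)" for \<mu> \<omega>

  have \<tau>_eq: "(\<Sum>l=1..N. c * p l (real d *\<^sub>R \<omega>) * e l \<omega>) + (\<Sum>l=N+1..M. c * e l \<omega>) = \<tau> \<omega>" for \<omega>
  proof -
    have "{1..M} = {1..N} \<union> {N+1..M}" using M by auto
    then have "\<tau> \<omega> = (\<Sum>l=1..N. c * (P l \<omega> * e l \<omega>)) + (\<Sum>l=N+1..M. c * (P l \<omega> * e l \<omega>))"
      unfolding \<tau>_def sum_distrib_left by (simp only:) (rule sum.union_disjoint, auto)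
    then show ?thesis
      by (simp add: P_def mult.assoc)
  qed
  have qC_eq: "(if \<mu> \<le> N then e \<mu> \<omega> - c * \<tau> \<omega> * cnj (p \<mu> (real d *\<^sub>R \<omega>))
      else e \<mu> \<omega> - c * \<tau> \<omega>) = qC \<mu> \<omega>" for \<mu> \<omega>
    by (simp add: qC_def P_def)

  \<comment> \<open>Real coefficients and values at the origin\<close>
  have mask_e: "mask (e l)" for l unfolding e_def by (rule mask_exp)
  have mask_E: "mask (E l)" for l
    using mask_exp[of "int d *s \<xi> l"] unfolding E_def by (simp add: real_vec_smult)
  have mask_E': "mask (E' l)" for l
    using mask_exp[of "- (int d *s \<xi> l)"] unfolding E'_def
    by (simp add: real_vec_smult real_vec_minus)
  have mask_p: "mask (p l)" for l
    unfolding p_def by (intro mask_poly mask_exp)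
  \<comment> \<open>Dilating the argument of \<open>p l\<close> turns its exponential into
    \<open>E l\<close>; both the mask property and the periodicity of \<open>P l\<close> are read
    off from this form.\<close>
  have P_eq: "P l = (if l \<le> N then (\<lambda>\<omega>. poly (map_poly of_real (g l)) (E l \<omega>)) else (\<lambda>\<omega>. of_real 1))" for l
    by (auto simp: P_def p_def E_def fun_eq_iff)
  have mask_P: "mask (P l)" for l
    unfolding P_eq by (cases "l \<le> N") (simp_all only: if_True if_False mask_poly mask_E mask_of_real)
  have mask_c: "mask (\<lambda>\<omega> :: real ^ 'n. c)" unfolding c_def by (rule mask_of_real)
  have mask_\<tau>: "mask \<tau>"
    unfolding \<tau>_def by (intro mask_mult mask_sum mask_c mask_P mask_e)
  have mask_half: "mask (\<lambda>\<omega> :: real ^ 'n. 1 / 2 ^ k)" for k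
    using mask_of_real[of "1 / 2 ^ k"] by simp
  have mask_1: "mask (\<lambda>\<omega> :: real ^ 'n. 1)"
    using mask_of_real[of 1] by simp
  have mask_qD: "mask (qD l)" for l
    unfolding qD_def by (intro mask_mult mask_c mask_half mask_power mask_diff mask_1 mask_E' mask_\<tau>)
  have mask_qC: "mask (qC \<mu>)" for \<mu>
    unfolding qC_def by (intro mask_diff mask_mult mask_e mask_c mask_\<tau> mask_cnj mask_P)

  have P0: "P l 0 = 1" if "l \<in> {1..M}" for l
    using g1[of l] complex_poly_of_real[of "g l" 1] that by (auto simp: P_def p_def)
  have e0: "e l 0 = 1" for l by (simp add: e_def)
  have \<tau>0: "\<tau> 0 = c * of_nat M" by (simp add: \<tau>_def P0 e0)
  have lowpass: "lowpass_mask d \<tau>"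
    by (simp add: lowpass_mask_def mask_\<tau> \<tau>0 cM)
  \<comment> \<open>Positivity of \<open>m l\<close> makes the power of \<open>1 - E' l\<close>
    vanish at the origin.\<close>
  have wD: "wavelet_mask (qD l)" if "l \<in> {1..N}" for l
    using mask_qD assms(3) that by (auto simp: wavelet_mask_def qD_def E'_def)
  \<comment> \<open>At the origin this is 1 - \<open>c * (c * of_nat M)\<close>, which is 0 by
    \<open>ccM\<close>.\<close>
  have wC: "wavelet_mask (qC \<mu>)" if "\<mu> \<in> {1..M}" for \<mu>
    by (simp add: wavelet_mask_def mask_qC qC_def e0 \<tau>0 P0[OF that] ccM)

  \<comment> \<open>\<open>p\<close> uses the positive and \<open>E'\<close> the negative exponent;
    both squared norms depend only on the cosine, so they still add up to 1.\<close>
  have PD: "(norm (D l \<omega>))\<^sup>2 + (norm (P l \<omega>))\<^sup>2 = 1" if "l \<in> {1..M}" for l \<omega>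
  proof (cases "l \<le> N")
    case True
    then show ?thesis
      using g[of l "real d * (real_vec (\<xi> l) \<bullet> \<omega>)"] that
        norm_half_one_minus_exp_power[of "m l" "real d * (real_vec (\<xi> l) \<bullet> \<omega>)"]
      by (simp add: D_def P_eq E_def E'_def)
  qed (simp add: D_def P_def)

  \<comment> \<open>Invariance under shifts and character sums\<close>
  have periodic: "P l (\<omega> + \<gamma>) = P l \<omega>" "E' l (\<omega> + \<gamma>) = E' l \<omega>"
    if \<gamma>: "\<gamma> \<in> scaled_lattice (2 * pi / real d)" for l \<omega> \<gamma>
  proof -
    obtain k where k: "\<gamma> = (2 * pi / real d) *\<^sub>R real_vec k"
      using \<gamma> by (auto simp: scaled_lattice_def)
    have "E l (\<omega> + \<gamma>) = E l \<omega> * exp (\<i> * of_real (real_vec (\<xi> l) \<bullet> ((2 * pi) *\<^sub>R real_vec k)))"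
      unfolding E_def exp_add[symmetric] k using d0
      by (simp add: inner_add_right distrib_left)
    then have E: "E l (\<omega> + \<gamma>) = E l \<omega>" by (simp only: exp_real_vec_eq_1 mult_1_right)
    then show "P l (\<omega> + \<gamma>) = P l \<omega>" by (simp add: P_eq)
    have "E' l \<omega> = inverse (E l \<omega>)" for \<omega> by (simp add: E_def E'_def exp_minus)
    then show "E' l (\<omega> + \<gamma>) = E' l \<omega>" by (simp add: E)
  qed

  have \<Gamma>_sub: "\<Gamma> \<subseteq> scaled_lattice (2 * pi / real d)"
    using assms(9) by (simp add: complete_coset_reps_def)
  have fin: "finite \<Lambda>" using assms(8) bij_betw_finite by blast
  have sum_e: "(\<Sum>l=1..M. e l \<omega> * cnj (e l (\<omega> + \<gamma>))) = (if \<gamma> = 0 then of_nat M else 0)"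
    if \<gamma>: "\<gamma> \<in> \<Gamma>" for \<omega> \<gamma>
  proof -
    have "e l \<omega> * cnj (e l (\<omega> + \<gamma>)) = cnj (exp (\<i> * of_real (real_vec (\<nu> l) \<bullet> \<gamma>)))" for l
      by (simp add: e_def exp_cnj exp_add[symmetric] inner_add_right algebra_simps)
    then have "(\<Sum>l=1..M. e l \<omega> * cnj (e l (\<omega> + \<gamma>))) =
        cnj (\<Sum>l=1..M. exp (\<i> * of_real (real_vec (\<nu> l) \<bullet> \<gamma>)))"
      by simp
    also have "(\<Sum>l=1..M. exp (\<i> * of_real (real_vec (\<nu> l) \<bullet> \<gamma>))) =
        (\<Sum>k\<in>\<Lambda>. exp (\<i> * of_real (real_vec k \<bullet> \<gamma>)))"
      unfolding M_def by (rule sum.reindex_bij_betw[OF assms(8)])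
    finally have sum: "(\<Sum>l=1..M. e l \<omega> * cnj (e l (\<omega> + \<gamma>))) =
        cnj (\<Sum>k\<in>\<Lambda>. exp (\<i> * of_real (real_vec k \<bullet> \<gamma>)))" .
    show ?thesis
    proof (cases "\<gamma> = 0")
      case True
      then show ?thesis
        using sum bij_betw_same_card[OF assms(8)] by (simp add: M_def)
    next
      case False
      \<comment> \<open>Otherwise 0 and \<gamma> would be two distinct representatives in \<Gamma>
        of the same coset.\<close>
      have "\<gamma> \<notin> scaled_lattice (2 * pi)"
      proof
        assume "\<gamma> \<in> scaled_lattice (2 * pi)"
        then have "\<gamma> - 0 \<in> scaled_lattice (2 * pi)" by simp
        moreover have "\<gamma> - \<gamma> \<in> scaled_lattice (2 * pi)"
          unfolding scaled_lattice_def by (rule range_eqI[where x = 0]) (simp add: real_vec_0)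
        moreover have "\<exists>!r. r \<in> \<Gamma> \<and> \<gamma> - r \<in> scaled_lattice (2 * pi)"
          using assms(9) \<Gamma>_sub \<gamma> unfolding complete_coset_reps_def by blast
        ultimately show False using \<gamma> assms(10) False by metis
      qed
      then have "(\<Sum>k\<in>\<Lambda>. exp (\<i> * of_real (real_vec k \<bullet> \<gamma>))) = 0"
        using sum_exp_coset_reps[OF assms(6) fin d0, of \<gamma>] \<Gamma>_sub \<gamma> by blast
      then show ?thesis using False by (simp only: sum complex_cnj_zero if_False)
    qed
  qed

  \<comment> \<open>The filter bank condition\<close>
  have tight: "tight_wavelet_filter_bank d \<Gamma> \<tau> (map qD [1..<N + 1] @ map qC [1..<M + 1])"
    unfolding tight_wavelet_filter_bank_def
  proof (intro conjI ballI allI)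
    show "lowpass_mask d \<tau>" by (fact lowpass)
    show "trig_poly q" if "q \<in> set (map qD [1..<N + 1] @ map qC [1..<M + 1])" for q
      using that trig_poly_mask[OF mask_qD] trig_poly_mask[OF mask_qC] by auto
    fix \<omega> \<gamma> assume \<gamma>: "\<gamma> \<in> \<Gamma>"
    then have \<gamma>': "\<gamma> \<in> scaled_lattice (2 * pi / real d)" using \<Gamma>_sub by blast
    have "(\<Sum>q\<leftarrow>map qD [1..<N + 1]. q \<omega> * cnj (q (\<omega> + \<gamma>))) =
        (\<Sum>l=1..N. qD l \<omega> * cnj (qD l (\<omega> + \<gamma>)))"
      by (simp add: comp_def interv_sum_list_conv_sum_set_nat atLeastLessThanSuc_atLeastAtMost del: upt_Suc)
    also have "\<dots> = (\<Sum>l=1..N. (c * D l \<omega> * \<tau> \<omega>) * cnj (c * D l \<omega> * \<tau> (\<omega> + \<gamma>)))"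
      by (intro sum.cong) (auto simp: qD_def D_def periodic(2)[OF \<gamma>'])
    \<comment> \<open>The added terms vanish because \<open>D l\<close> is 0 above \<open>N\<close>;
      both sums now share the index set required by
      \<open>tight_filter_bank_identity\<close>.\<close>
    also have "\<dots> = (\<Sum>l=1..M. (c * D l \<omega> * \<tau> \<omega>) * cnj (c * D l \<omega> * \<tau> (\<omega> + \<gamma>)))"
      using M by (intro sum.mono_neutral_left) (auto simp: D_def)
    finally have sD: "(\<Sum>q\<leftarrow>map qD [1..<N + 1]. q \<omega> * cnj (q (\<omega> + \<gamma>))) =
        (\<Sum>l=1..M. (c * D l \<omega> * \<tau> \<omega>) * cnj (c * D l \<omega> * \<tau> (\<omega> + \<gamma>)))" .
    have "(\<Sum>q\<leftarrow>map qC [1..<M + 1]. q \<omega> * cnj (q (\<omega> + \<gamma>))) =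
        (\<Sum>l=1..M. qC l \<omega> * cnj (qC l (\<omega> + \<gamma>)))"
      by (simp add: comp_def interv_sum_list_conv_sum_set_nat atLeastLessThanSuc_atLeastAtMost del: upt_Suc)
    then have sC: "(\<Sum>q\<leftarrow>map qC [1..<M + 1]. q \<omega> * cnj (q (\<omega> + \<gamma>))) =
        (\<Sum>l=1..M. (e l \<omega> - c * \<tau> \<omega> * cnj (P l \<omega>)) *
          cnj (e l (\<omega> + \<gamma>) - c * \<tau> (\<omega> + \<gamma>) * cnj (P l \<omega>)))"
      by (simp only: qC_def periodic(1)[OF \<gamma>'])
    have "\<tau> \<omega> * cnj (\<tau> (\<omega> + \<gamma>)) +
        ((\<Sum>l=1..M. (c * D l \<omega> * \<tau> \<omega>) * cnj (c * D l \<omega> * \<tau> (\<omega> + \<gamma>))) +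
         (\<Sum>l=1..M. (e l \<omega> - c * \<tau> \<omega> * cnj (P l \<omega>)) *
          cnj (e l (\<omega> + \<gamma>) - c * \<tau> (\<omega> + \<gamma>) * cnj (P l \<omega>)))) =
        (\<Sum>l=1..M. e l \<omega> * cnj (e l (\<omega> + \<gamma>)))"
      unfolding c_def
    proof (rule tight_filter_bank_identity)
      show "cr\<^sup>2 * real (card {1..M}) = 1" using crM by simp
      show "\<tau> \<omega> = of_real cr * (\<Sum>l=1..M. P l \<omega> * e l \<omega>)"
        by (simp only: \<tau>_def c_def)
      show "\<tau> (\<omega> + \<gamma>) = of_real cr * (\<Sum>l=1..M. P l \<omega> * e l (\<omega> + \<gamma>))"
        by (simp only: \<tau>_def c_def periodic(1)[OF \<gamma>'])
    qed (rule PD)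
    also have "\<dots> = (if \<gamma> = 0 then of_nat d ^ CARD('n) else 0)"
      using sum_e[OF \<gamma>] by (simp add: M_def)
    finally show "\<tau> \<omega> * cnj (\<tau> (\<omega> + \<gamma>)) +
        (\<Sum>q\<leftarrow>map qD [1..<N + 1] @ map qC [1..<M + 1]. q \<omega> * cnj (q (\<omega> + \<gamma>))) =
        (if \<gamma> = 0 then of_nat d ^ CARD('n) else 0)"
      unfolding map_append sum_list_append sD sC .
  qed

  show ?thesis
    unfolding Let_def
  proof (intro exI[of _ p], fold cr_def M_def, fold c_def, fold e_def E'_def, unfold \<tau>_eq qC_eq,
      fold qD_def, intro conjI ballI)
    show "trig_poly (p l)" for l by (rule trig_poly_mask[OF mask_p])
    show "lowpass_mask d \<tau>" by (fact lowpass)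
    show "wavelet_mask (qD l)" if "l \<in> {1..N}" for l using that by (rule wD)
    show "wavelet_mask (qC \<mu>)" if "\<mu> \<in> {1..M}" for \<mu> using that by (rule wC)
    show "tight_wavelet_filter_bank d \<Gamma> \<tau> (map qD [1..<N + 1] @ map qC [1..<M + 1])"
      by (fact tight)
  qed
qed

end
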